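(* Let $A,E\in\mathbb{C}^{n,n}$ be Hermitian, let $L(s)=A+sE$ be a regular pencil, and let $(\lambda_1,\dots,\lambda_{n+1})\in\mathcal{K}\setminus\mathbb{R}^{n+1}$. Then $$\delta^{\mathrm{Herm}}(A,E)^2\ \ge\ \max_{j=1,\dots,n+1}\Big(\min_{t_0,t_1\in\mathbb{R}}\lambda_{\max}\big(G_j+t_0H_{1j}+t_1H_{2j}\big)\Big)^{-1},$$ where, for each $j=1,\dots,n+1$, $M_j=(L(\lambda_j))^{-1}$ and $$G_j=\begin{bmatrix}I_n\\ \bar\lambda_jI_n\end{bmatrix}M_j^*M_j\begin{bmatrix}I_n&\lambda_jI_n\end{bmatrix},\quad H_{1j}=i\begin{bmatrix}M_j-M_j^*&\lambda_jM_j\\ -\bar\lambda_jM_j^*&0\end{bmatrix},\quad H_{2j}=i\begin{bmatrix}0&-M_j^*\\ M_j&\lambda_jM_j-\bar\lambda_jM_j^*\end{bmatrix}.$$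
   Context: $\mathbb{C}^{n,n}$ is the set of complex $n\times n$ matrices and $\mathrm{Herm}(n)$ the set of Hermitian ones; in the matrices $H_{1j},H_{2j}$ the prefactor $i$ is the imaginary unit. A pencil $L(s)=A+sE$ is regular if $L(\lambda)$ is invertible for some $\lambda\in\mathbb{C}$. $\|\cdot\|$ is the spectral norm and $\lambda_{\max}(H)$ is the largest eigenvalue of a Hermitian matrix $H$. The set $$\mathcal{K}=\{(\lambda_1,\dots,\lambda_{n+1})\in\mathbb{C}^{n+1}\;:\;\lambda_i\neq\lambda_j \text{ for } i\neq j,\ L(\lambda_i)\text{ invertible for all } i=1,\dots,n+1\}.$$ The Hermitian distance to singularity is $$\delta^{\mathrm{Herm}}(A,E)=\inf\Big\{\sqrt{\|\Delta_A\|^2+\|\Delta_E\|^2}\;:\;\Delta_A,\Delta_E\in\mathrm{Herm}(n),\ \det\big((A-\Delta_A)+\lambda(E-\Delta_E)\big)=0\text{ for all }\lambda\in\mathbb{C}\Big\}.$$ *)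

theory Defs
  imports "HOL-Analysis.Analysis"
begin

definition conj_transpose :: "complex^'n^'m \<Rightarrow> complex^'m^'n" where
  "conj_transpose A = (\<chi> i j. cnj (A $ j $ i))"

definition hermitian :: "complex^'n^'n \<Rightarrow> bool" where
  "hermitian A \<longleftrightarrow> conj_transpose A = A"

text \<open>The library provides \<open>*s\<close> for a complex multiple of a vector and \<open>*\<^sub>R\<close> for a real
  multiple of a matrix, but no complex multiple of a matrix.\<close>

definition smult_mat :: "complex \<Rightarrow> complex^'n^'m \<Rightarrow> complex^'n^'m"  (infixr "*\<^sub>m" 75) where
  "c *\<^sub>m A = (\<chi> i j. c * A $ i $ j)"

text \<open>Block matrices are indexed by sum types; \<open>Inl\<close> is the first block of rows or columns,
  so \<open>complex^('n+'n)^('n+'n)\<close> is the type of \<open>2n\<close> by \<open>2n\<close> matrices.\<close>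

definition block_row :: "complex^'c^'r \<Rightarrow> complex^'d^'r \<Rightarrow> complex^('c+'d)^'r" where
  "block_row A B = (\<chi> i j. case j of Inl k \<Rightarrow> A $ i $ k | Inr k \<Rightarrow> B $ i $ k)"

definition block_col :: "complex^'c^'r \<Rightarrow> complex^'c^'s \<Rightarrow> complex^'c^('r+'s)" where
  "block_col A B = (\<chi> i. case i of Inl k \<Rightarrow> A $ k | Inr k \<Rightarrow> B $ k)"

definition block_mat ::
    "complex^'c^'r \<Rightarrow> complex^'d^'r \<Rightarrow> complex^'c^'s \<Rightarrow> complex^'d^'s \<Rightarrow> complex^('c+'d)^('r+'s)" where
  "block_mat A B C D = block_col (block_row A B) (block_row C D)"

text \<open>The norm on \<open>complex^'n\<close> is the Euclidean one, so its operator norm is the spectral norm.\<close>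

definition spectral_norm :: "complex^'n^'m \<Rightarrow> real" where
  "spectral_norm A = onorm (\<lambda>x. A *v x)"

text \<open>For Hermitian \<open>H\<close> all eigenvalues are real, and the set below is finite and nonempty.\<close>

definition lambda_max :: "complex^'n^'n \<Rightarrow> real" where
  "lambda_max H = Max {x :: real. \<exists>v. v \<noteq> 0 \<and> H *v v = of_real x *s v}"

definition pencil :: "complex^'n^'n \<Rightarrow> complex^'n^'n \<Rightarrow> complex \<Rightarrow> complex^'n^'n" where
  "pencil A E z = A + z *\<^sub>m E"

definition regular_pencil :: "complex^'n^'n \<Rightarrow> complex^'n^'n \<Rightarrow> bool" where
  "regular_pencil A E \<longleftrightarrow> (\<exists>z. invertible (pencil A E z))"

definition herm_dist :: "complex^'n^'n \<Rightarrow> complex^'n^'n \<Rightarrow> real" where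
  "herm_dist A E =
     Inf {sqrt ((spectral_norm DA)\<^sup>2 + (spectral_norm DE)\<^sup>2) | DA DE.
            hermitian DA \<and> hermitian DE \<and> (\<forall>z. det (pencil (A - DA) (E - DE) z) = 0)}"

text \<open>An \<open>(n+1)\<close>-tuple is a function of type \<open>nat \<Rightarrow> complex\<close> of which only the values on
  \<open>{1..CARD('n) + 1}\<close> matter.\<close>

definition admissible_points :: "complex^'n^'n \<Rightarrow> complex^'n^'n \<Rightarrow> (nat \<Rightarrow> complex) set" where
  "admissible_points A E =
     {l. (\<forall>i \<in> {1..CARD('n) + 1}. \<forall>j \<in> {1..CARD('n) + 1}. i \<noteq> j \<longrightarrow> l i \<noteq> l j) \<and>
         (\<forall>i \<in> {1..CARD('n) + 1}. invertible (pencil A E (l i)))}"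

text \<open>In the following definitions \<open>z\<close> is a point at which the pencil is invertible and \<open>M\<close> is the
  inverse of the pencil at \<open>z\<close>.\<close>

definition G_mat :: "complex \<Rightarrow> complex^'n^'n \<Rightarrow> complex^('n+'n)^('n+'n)" where
  "G_mat z M =
     block_col (mat 1) (cnj z *\<^sub>m mat 1) ** conj_transpose M ** M ** block_row (mat 1) (z *\<^sub>m mat 1)"

definition H1_mat :: "complex \<Rightarrow> complex^'n^'n \<Rightarrow> complex^('n+'n)^('n+'n)" where
  "H1_mat z M =
     \<i> *\<^sub>m block_mat (M - conj_transpose M)             (z *\<^sub>m M)
                    (- (cnj z *\<^sub>m conj_transpose M))   0"

definition H2_mat :: "complex \<Rightarrow> complex^'n^'n \<Rightarrow> complex^('n+'n)^('n+'n)" where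
  "H2_mat z M =
     \<i> *\<^sub>m block_mat 0   (- conj_transpose M)
                    M   (z *\<^sub>m M - cnj z *\<^sub>m conj_transpose M)"

definition lambda_max_param ::
    "complex^'n^'n \<Rightarrow> complex^'n^'n \<Rightarrow> complex \<Rightarrow> real \<Rightarrow> real \<Rightarrow> real" where
  "lambda_max_param A E z t0 t1 =
     (let M = matrix_inv (pencil A E z)
      in lambda_max (G_mat z M + t0 *\<^sub>R H1_mat z M + t1 *\<^sub>R H2_mat z M))"

text \<open>The minimum of a function of two real variables; \<open>LEAST\<close> denotes a meaningful value only if
  the minimum is attained.\<close>

definition min2 :: "(real \<Rightarrow> real \<Rightarrow> real) \<Rightarrow> real" where
  "min2 f = (LEAST r. \<exists>t0 t1. r = f t0 t1)"

end

theory Submission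
  imports Defs
begin

text \<open>
  Fix a point \<open>z\<close> at which the pencil \<open>L\<close> is invertible, and put \<open>M = L(z)\<inverse>\<close>. Suppose that Hermitian
  perturbations \<open>DA\<close>, \<open>DE\<close> make the perturbed pencil singular at \<open>z\<close>. A kernel vector \<open>x\<close> satisfies
  \<open>L(z) x = a + z e\<close> with \<open>a = DA x\<close> and \<open>e = DE x\<close>, that is, \<open>x = M (a + z e)\<close>. At the stacked
  vector \<open>w = (a, e)\<close> the form of \<open>G\<close> equals the squared norm of \<open>x\<close>, whereas the forms of \<open>H1\<close> and
  \<open>H2\<close> equal, up to a factor, the imaginary parts of \<open>x\<^sup>* DA x\<close> and \<open>x\<^sup>* DE x\<close>, which vanish. The
  Rayleigh bound for \<open>G + t0 H1 + t1 H2\<close> at \<open>w\<close>, together with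
  \<open>\<parallel>w\<parallel>\<^sup>2 \<le> (\<parallel>DA\<parallel>\<^sup>2 + \<parallel>DE\<parallel>\<^sup>2) \<parallel>x\<parallel>\<^sup>2\<close>, therefore gives
  \<open>1 \<le> \<lambda>\<^sub>m\<^sub>a\<^sub>x(G + t0 H1 + t1 H2) (\<parallel>DA\<parallel>\<^sup>2 + \<parallel>DE\<parallel>\<^sup>2)\<close> for all real \<open>t0\<close>, \<open>t1\<close>
  (\<open>singular_perturbation_bound\<close>). Taking the infimum over the perturbations yields the lower bound on
  the distance; the particular choice \<open>DA = A\<close>, \<open>DE = E\<close> shows that the values of \<open>\<lambda>\<^sub>m\<^sub>a\<^sub>x\<close> are positive.

  The minimum over \<open>(t0, t1)\<close> is attained because \<open>\<lambda>\<^sub>m\<^sub>a\<^sub>x\<close> is convex, hence continuous, and because no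
  combination \<open>t0 H1 + t1 H2\<close> is negative semidefinite unless it is zero
  (\<open>H_combination_not_semidefinite\<close>). The function then grows at least linearly on the orthogonal complement of
  the kernel of \<open>(t0, t1) \<mapsto> t0 H1 + t1 H2\<close> and is constant along that kernel
  (\<open>lambda_max_affine_attains_min\<close>). Working modulo the kernel treats real points \<open>z\<close>, where \<open>H1\<close> and
  \<open>H2\<close> are linearly dependent, together with the nonreal ones.

  All quadratic forms are written with the real inner product of \<open>complex^'n\<close>, which is the real part of
  the Hermitian one. The form of a Hermitian matrix is real, so nothing is lost, and the imaginary part of
  \<open>u\<^sup>* v\<close> is recovered as \<open>- u \<bullet> (\<i> *s v)\<close>.
\<close>

section \<open>Hermitian matrices and the real inner product\<close>

lemma inner_cscale: "(c *s u) \<bullet> (v :: complex^'n) = u \<bullet> (cnj c *s v)"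
  by (simp add: inner_vec_def inner_complex_def algebra_simps)

lemma inner_conj_transpose: "(M *v u) \<bullet> v = u \<bullet> (conj_transpose M *v v)"
  for M :: "complex^'n^'m"
proof -
  have move: "(a * b) \<bullet> c = b \<bullet> (cnj a * c)" for a b c :: complex
    by (simp add: inner_complex_def algebra_simps)
  have "(M *v u) \<bullet> v = (\<Sum>i\<in>UNIV. \<Sum>j\<in>UNIV. (M $ i $ j * u $ j) \<bullet> (v $ i))"
    by (simp add: inner_vec_def matrix_vector_mult_def inner_sum_left)
  also have "\<dots> = (\<Sum>j\<in>UNIV. \<Sum>i\<in>UNIV. (M $ i $ j * u $ j) \<bullet> (v $ i))"
    by (rule sum.swap)
  also have "\<dots> = u \<bullet> (conj_transpose M *v v)"
    unfolding move
    by (simp add: inner_vec_def matrix_vector_mult_def inner_sum_right conj_transpose_def)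
  finally show ?thesis .
qed

lemma matrix_vector_mult_cscale: "M *v (c *s v) = c *s (M *v v)" for M :: "complex^'n^'m"
  by (simp add: vec_eq_iff matrix_vector_mult_def sum_distrib_left algebra_simps)

lemma smult_mat_mult_vec: "(c *\<^sub>m M) *v v = c *s (M *v v)" for M :: "complex^'n^'m"
  by (simp add: vec_eq_iff matrix_vector_mult_def sum_distrib_left smult_mat_def algebra_simps)

lemma uminus_mat_mult_vec: "(- M) *v v = - (M *v v)" for M :: "complex^'n^'m"
  by (simp add: vec_eq_iff matrix_vector_mult_def sum_negf)

lemma scaleR_mat_mult_vec: "(c *\<^sub>R M) *v v = c *\<^sub>R (M *v v)" for M :: "complex^'n^'m"
  by (simp add: vec_eq_iff matrix_vector_mult_def scaleR_sum_right algebra_simps)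

lemma scaleR_eq_cscale: "t *\<^sub>R v = of_real t *s v" for v :: "complex^'n"
  unfolding vec_eq_iff vector_scaleR_component vector_smult_component by (simp add: scaleR_conv_of_real)

lemma matrix_vector_mult_scale: "M *v (t *\<^sub>R v) = t *\<^sub>R (M *v v)" for M :: "complex^'n^'m"
  by (rule linear_scale[OF matrix_vector_mul_linear])

text \<open>For a complex matrix, self-adjointness with respect to the real inner product suffices: both the
  matrix and its conjugate transpose act as a real adjoint, and that adjoint is unique.\<close>

lemma hermitian_iff_self_adjoint:
  "hermitian H \<longleftrightarrow> (\<forall>u v. (H *v u) \<bullet> v = u \<bullet> (H *v v))"
proof
  show "hermitian H \<Longrightarrow> \<forall>u v. (H *v u) \<bullet> v = u \<bullet> (H *v v)"
    by (simp add: inner_conj_transpose hermitian_def)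
next
  assume "\<forall>u v. (H *v u) \<bullet> v = u \<bullet> (H *v v)"
  then have "u \<bullet> (conj_transpose H *v v - H *v v) = 0" for u v
    by (simp add: inner_conj_transpose inner_diff_right)
  then have "conj_transpose H *v v - H *v v = 0" for v
    using inner_eq_zero_iff by blast
  then show "hermitian H"
    by (simp add: hermitian_def matrix_eq)
qed

lemma hermitian_swap: "hermitian H \<Longrightarrow> (H *v u) \<bullet> v = u \<bullet> (H *v v)"
  by (simp add: hermitian_iff_self_adjoint)

lemma hermitian_add: "hermitian H \<Longrightarrow> hermitian K \<Longrightarrow> hermitian (H + K)"
  by (simp add: hermitian_iff_self_adjoint matrix_vector_mult_add_rdistrib inner_add_left inner_add_right)

lemma hermitian_scaleR: "hermitian H \<Longrightarrow> hermitian (c *\<^sub>R H)"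
  by (simp add: hermitian_iff_self_adjoint scaleR_mat_mult_vec)

text \<open>This is the realness of \<open>x\<^sup>* H x\<close>.\<close>

lemma hermitian_inner_imaginary:
  assumes "hermitian H"
  shows "(H *v x) \<bullet> (\<i> *s x) = 0"
proof -
  have "(H *v x) \<bullet> (\<i> *s x) = x \<bullet> (\<i> *s (H *v x))"
    using assms by (simp add: hermitian_swap matrix_vector_mult_cscale)
  also have "\<dots> = - ((H *v x) \<bullet> (\<i> *s x))"
    using inner_cscale[of \<i> x "H *v x"]
    by (simp add: inner_commute)
  finally show ?thesis by simp
qed

text \<open>The form decreases to first order when \<open>v\<close> is moved against \<open>H v\<close>, so \<open>H v\<close> must vanish at a
  zero of a nonnegative form.\<close>

lemma psd_isotropic_in_kernel:
  fixes H :: "complex^'n^'n"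
  assumes "hermitian H" and psd: "\<And>w. w \<bullet> (H *v w) \<ge> 0" and v: "v \<bullet> (H *v v) = 0"
  shows "H *v v = 0"
proof (rule ccontr)
  define u where "u = H *v v"
  assume "H *v v \<noteq> 0"
  then have pos: "u \<bullet> u > 0" by (simp add: u_def)
  define a where "a = u \<bullet> (H *v u)"
  \<comment> \<open>A step so short that the quadratic term \<open>e\<^sup>2 a\<close> cannot compensate the linear decrease \<open>2 e (u \<bullet> u)\<close>.\<close>
  define e where "e = (u \<bullet> u) / (1 + a)"
  have a: "a \<ge> 0" using psd a_def by simp
  then have "e > 0" using pos by (simp add: e_def)
  have *: "v \<bullet> (H *v u) = u \<bullet> u"
    using assms(1) by (metis hermitian_swap u_def)
  have "0 \<le> (v - e *\<^sub>R u) \<bullet> (H *v (v - e *\<^sub>R u))" by (rule psd)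
  also have "\<dots> = e * (e * a - 2 * (u \<bullet> u))"
    using v * by (simp add: matrix_vector_mult_diff_distrib matrix_vector_mult_scale
        inner_diff_left inner_diff_right flip: u_def a_def) (simp add: algebra_simps)
  finally have "2 * (u \<bullet> u) \<le> e * a" using \<open>e > 0\<close> by (simp add: zero_le_mult_iff)
  moreover have "e * a \<le> u \<bullet> u" using a pos by (simp add: e_def field_simps)
  ultimately show False using pos by simp
qed

section \<open>The largest eigenvalue as the maximum of the Rayleigh quotient\<close>

text \<open>Eigenvectors for distinct eigenvalues are orthogonal, hence independent.\<close>

lemma finite_eigenvalues:
  fixes H :: "complex^'n^'n"
  assumes "hermitian H"
  shows "finite {x :: real. \<exists>v. v \<noteq> 0 \<and> H *v v = of_real x *s v}"
proof -
  define X where "X = {x :: real. \<exists>v. v \<noteq> 0 \<and> H *v v = of_real x *s v}"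
  have "\<forall>x\<in>X. \<exists>v. v \<noteq> 0 \<and> H *v v = x *\<^sub>R v"
    by (simp add: scaleR_eq_cscale X_def)
  from bchoice[OF this] obtain e where e: "\<And>x. x \<in> X \<Longrightarrow> e x \<noteq> 0 \<and> H *v e x = x *\<^sub>R e x"
    by blast
  have orth: "e x \<bullet> e y = 0" if "x \<in> X" "y \<in> X" "x \<noteq> y" for x y
    using hermitian_swap[OF assms, of "e x" "e y"] e[OF that(1)] e[OF that(2)] that(3) by simp
  have inj: "inj_on e X"
  proof (rule inj_onI)
    fix x y assume "x \<in> X" "y \<in> X" "e x = e y"
    then show "x = y" using orth[of x y] e[of x] by auto
  qed
  have "pairwise orthogonal (e ` X)"
    unfolding pairwise_def orthogonal_def using orth by blast
  moreover have "0 \<notin> e ` X" using e by force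
  ultimately have "independent (e ` X)" by (rule pairwise_orthogonal_independent)
  then have "finite (e ` X)" by (rule independent_imp_finite)
  with inj have "finite X" using finite_imageD by blast
  then show ?thesis by (simp add: X_def)
qed

text \<open>The maximum \<open>m\<close> of the quotient over the unit sphere makes \<open>m I - H\<close> positive semidefinite, and the
  form of \<open>m I - H\<close> vanishes at a maximizer, which is therefore an eigenvector.\<close>

lemma rayleigh_maximum:
  fixes H :: "complex^'n^'n"
  assumes "hermitian H"
  obtains m v where "norm v = 1" "H *v v = m *\<^sub>R v" "\<And>w. w \<bullet> (H *v w) \<le> m * (w \<bullet> w)"
proof -
  have "continuous_on (sphere 0 1) (\<lambda>w. w \<bullet> (H *v w))"
    by (intro continuous_intros linear_continuous_on linear_conv_bounded_linear[THEN iffD1]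
        matrix_vector_mul_linear)
  moreover have "sphere (0::complex^'n) 1 \<noteq> {}" by simp
  ultimately obtain v where v: "v \<in> sphere 0 1"
    "\<And>w. w \<in> sphere 0 1 \<Longrightarrow> w \<bullet> (H *v w) \<le> v \<bullet> (H *v v)"
    using continuous_attains_sup[OF compact_sphere] by blast
  define m where "m = v \<bullet> (H *v v)"
  have le: "w \<bullet> (H *v w) \<le> m * (w \<bullet> w)" for w
  proof (cases "w = 0")
    case False
    have "w /\<^sub>R norm w \<in> sphere 0 1" using False by simp
    then have "(w /\<^sub>R norm w) \<bullet> (H *v (w /\<^sub>R norm w)) \<le> m" unfolding m_def by (rule v)
    then show ?thesis using False
      by (simp add: matrix_vector_mult_scale dot_square_norm field_simps power2_eq_square)
  qed simp
  define K where "K = m *\<^sub>R mat 1 + (-1) *\<^sub>R H"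
  have K: "K *v w = m *\<^sub>R w - H *v w" for w
    by (simp add: K_def matrix_vector_mult_add_rdistrib scaleR_mat_mult_vec
        del: scaleR_minus_left scaleR_minus1_left) simp
  have 1: "norm v = 1" using v by simp
  have "K *v v = 0"
  proof (rule psd_isotropic_in_kernel)
    show "hermitian K" using assms unfolding hermitian_iff_self_adjoint K
      by (simp add: inner_diff_left inner_diff_right)
    show "w \<bullet> (K *v w) \<ge> 0" for w using le[of w] by (simp add: K inner_diff_right)
    show "v \<bullet> (K *v v) = 0" using 1 by (simp add: K inner_diff_right m_def dot_square_norm)
  qed
  then show ?thesis using that[OF 1 _ le] by (simp add: K)
qed

theorem
  fixes H :: "complex^'n^'n"
  assumes "hermitian H"
  shows rayleigh_le_lambda_max: "w \<bullet> (H *v w) \<le> lambda_max H * (w \<bullet> w)"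
    and rayleigh_attains_lambda_max: "\<exists>v. norm v = 1 \<and> v \<bullet> (H *v v) = lambda_max H"
proof -
  obtain m v where m: "norm v = 1" "H *v v = m *\<^sub>R v" "\<And>w. w \<bullet> (H *v w) \<le> m * (w \<bullet> w)"
    using rayleigh_maximum[OF assms] by blast
  have "lambda_max H = m"
    unfolding lambda_max_def
  proof (rule Max_eqI[OF finite_eigenvalues[OF assms]])
    show "m \<in> {x. \<exists>v. v \<noteq> 0 \<and> H *v v = of_real x *s v}"
      using m(1,2) by (auto simp: scaleR_eq_cscale intro!: exI[of _ v])
  next
    fix x assume "x \<in> {x. \<exists>v. v \<noteq> 0 \<and> H *v v = of_real x *s v}"
    then obtain u where u: "u \<noteq> 0" "H *v u = x *\<^sub>R u" by (auto simp: scaleR_eq_cscale)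
    then have "x * (u \<bullet> u) \<le> m * (u \<bullet> u)" using m(3)[of u] by simp
    then show "x \<le> m" using u(1) by simp
  qed
  then show "w \<bullet> (H *v w) \<le> lambda_max H * (w \<bullet> w)"
    and "\<exists>v. norm v = 1 \<and> v \<bullet> (H *v v) = lambda_max H"
    using m by (auto simp: dot_square_norm intro!: exI[of _ v])
qed

lemma lambda_max_le:
  fixes H :: "complex^'n^'n"
  assumes "hermitian H" "\<And>w. norm w = 1 \<Longrightarrow> w \<bullet> (H *v w) \<le> c"
  shows "lambda_max H \<le> c"
  using rayleigh_attains_lambda_max[OF assms(1)] assms(2) by metis

lemma rayleigh_unit_le_lambda_max:
  fixes H :: "complex^'n^'n"
  assumes "hermitian H" "norm w = 1"
  shows "w \<bullet> (H *v w) \<le> lambda_max H"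
  using rayleigh_le_lambda_max[OF assms(1), of w] assms(2) by (simp add: dot_square_norm)

lemma lambda_max_subadditive:
  fixes H K :: "complex^'n^'n"
  assumes "hermitian H" "hermitian K"
  shows "lambda_max (H + K) \<le> lambda_max H + lambda_max K"
  using assms
  by (intro lambda_max_le hermitian_add)
    (auto simp: matrix_vector_mult_add_rdistrib inner_add_right
      intro!: add_mono rayleigh_unit_le_lambda_max)

lemma lambda_max_scaleR_le:
  fixes H :: "complex^'n^'n"
  assumes "hermitian H" "c \<ge> 0"
  shows "lambda_max (c *\<^sub>R H) \<le> c * lambda_max H"
  using assms
  by (intro lambda_max_le hermitian_scaleR)
    (auto simp: scaleR_mat_mult_vec intro!: mult_left_mono rayleigh_unit_le_lambda_max)

lemma lambda_max_scaleR:
  fixes H :: "complex^'n^'n"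
  assumes H: "hermitian H" and c: "c > 0"
  shows "lambda_max (c *\<^sub>R H) = c * lambda_max H"
proof (rule antisym)
  have "lambda_max ((1/c) *\<^sub>R c *\<^sub>R H) \<le> (1/c) * lambda_max (c *\<^sub>R H)"
    using assms by (intro lambda_max_scaleR_le hermitian_scaleR) auto
  then show "c * lambda_max H \<le> lambda_max (c *\<^sub>R H)" using c by (simp add: field_simps)
qed (use assms in \<open>simp add: lambda_max_scaleR_le\<close>)

text \<open>Continuity comes for free from convexity in a finite-dimensional space.\<close>

lemma continuous_on_lambda_max:
  fixes G :: "complex^'n^'n" and K :: "'a::euclidean_space \<Rightarrow> complex^'n^'n"
  assumes "hermitian G" and "linear K" and herm: "\<And>p. hermitian (K p)"
  shows "continuous_on S (\<lambda>p. lambda_max (G + K p))"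
proof -
  have "convex_on UNIV (\<lambda>p. lambda_max (G + K p))"
  proof (rule convex_onI)
    fix t :: real and p q assume t: "0 < t" "t < 1"
    have "G + K ((1 - t) *\<^sub>R p + t *\<^sub>R q) = (1 - t) *\<^sub>R (G + K p) + t *\<^sub>R (G + K q)"
    proof -
      have "K ((1 - t) *\<^sub>R p + t *\<^sub>R q) = (1 - t) *\<^sub>R K p + t *\<^sub>R K q"
        by (simp only: linear_add[OF assms(2)] linear_scale[OF assms(2)])
      then show ?thesis by (simp add: algebra_simps)
    qed
    also have "lambda_max \<dots> \<le> lambda_max ((1 - t) *\<^sub>R (G + K p)) + lambda_max (t *\<^sub>R (G + K q))"
      using assms by (intro lambda_max_subadditive hermitian_scaleR hermitian_add)
    also have "\<dots> = (1 - t) * lambda_max (G + K p) + t * lambda_max (G + K q)"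
      using t assms by (simp add: lambda_max_scaleR hermitian_add)
    finally show "lambda_max (G + K ((1 - t) *\<^sub>R p + t *\<^sub>R q)) \<le>
        (1 - t) * lambda_max (G + K p) + t * lambda_max (G + K q)" .
  qed simp
  then show ?thesis
    using convex_on_continuous continuous_on_subset open_UNIV by blast
qed

text \<open>Under the last hypothesis \<open>\<lambda>\<^sub>m\<^sub>a\<^sub>x(K p)\<close> is positive off the kernel of \<open>K\<close>, hence bounded below by
  some \<open>k > 0\<close> on the unit sphere of the orthogonal complement of that kernel. By subadditivity the function
  grows there at least like \<open>k \<parallel>p\<parallel>\<close>, and its minimum over a large enough ball is a global one.\<close>

theorem lambda_max_affine_attains_min:
  fixes G :: "complex^'n^'n" and K :: "'a::euclidean_space \<Rightarrow> complex^'n^'n"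
  assumes G: "hermitian G" and lin: "linear K" and herm: "\<And>p. hermitian (K p)"
    and indefinite: "\<And>p. (\<And>w. w \<bullet> (K p *v w) \<le> 0) \<Longrightarrow> K p = 0"
  shows "\<exists>p. \<forall>q. lambda_max (G + K p) \<le> lambda_max (G + K q)"
proof -
  define f where "f p = lambda_max (G + K p)" for p
  define N where "N = {p. K p = 0}"
  define S where "S = {p. \<forall>n\<in>N. orthogonal n p}"
  have "subspace N"
    using lin by (auto simp: N_def subspace_def linear_0 linear_add linear_scale)
  then have span: "span N = N" by (simp add: span_eq_iff)
  have reduce: "\<exists>p\<in>S. f q = f p" for q
  proof -
    obtain n p where "n \<in> span N" and p: "\<And>w. w \<in> span N \<Longrightarrow> orthogonal p w" and q: "q = n + p"
      using orthogonal_subspace_decomp_exists[of N q] by blast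
    then have "n \<in> N" by (simp add: span)
    then have "K n = 0" by (simp add: N_def)
    then have "K q = K p" using lin q by (simp add: linear_add)
    moreover have "p \<in> S" using p by (simp add: S_def span orthogonal_commute)
    ultimately show ?thesis by (auto simp: f_def)
  qed
  have "0 \<in> S" by (simp add: S_def orthogonal_def)
  have "subspace S" unfolding S_def by (rule subspace_orthogonal_to_vectors)
  then have "closed S" by (rule closed_subspace)
  have pos: "lambda_max (K p) > 0" if p: "p \<in> S" "p \<noteq> 0" for p
  proof -
    have "p \<notin> N" using p by (auto simp: S_def orthogonal_def)
    then have "K p \<noteq> 0" by (simp add: N_def)
    then obtain w where "w \<bullet> (K p *v w) > 0"
      using indefinite[of p] not_le by blast
    also have "\<dots> \<le> lambda_max (K p) * (w \<bullet> w)" by (rule rayleigh_le_lambda_max[OF herm])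
    finally show ?thesis using inner_ge_zero[of w] by (auto simp: zero_less_mult_iff)
  qed
  obtain k where k: "k > 0" "\<And>p. p \<in> S \<Longrightarrow> norm p = 1 \<Longrightarrow> k \<le> lambda_max (K p)"
  proof (cases "S \<inter> sphere 0 1 = {}")
    case True
    then show ?thesis by (intro that[of 1]) auto
  next
    case False
    have "continuous_on (S \<inter> sphere 0 1) (\<lambda>p. lambda_max (K p))"
      using continuous_on_lambda_max[OF _ lin herm, of 0] by (simp add: hermitian_iff_self_adjoint)
    moreover have "compact (S \<inter> sphere 0 1)" using \<open>closed S\<close> by (simp add: closed_Int_compact)
    ultimately have "\<exists>p\<in>S \<inter> sphere 0 1. \<forall>q\<in>S \<inter> sphere 0 1. lambda_max (K p) \<le> lambda_max (K q)"
      using False by (intro continuous_attains_inf)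
    then obtain p where p: "p \<in> S" "norm p = 1"
      "\<And>q. q \<in> S \<Longrightarrow> norm q = 1 \<Longrightarrow> lambda_max (K p) \<le> lambda_max (K q)"
      by auto
    moreover have "p \<noteq> 0" using p(2) by auto
    ultimately show ?thesis using pos[of p] that[of "lambda_max (K p)"] by simp
  qed
  define c where "c = lambda_max ((-1) *\<^sub>R G)"
  have growth: "k * norm p - c \<le> f p" if "p \<in> S" "p \<noteq> 0" for p
  proof -
    have "p /\<^sub>R norm p \<in> S" using \<open>subspace S\<close> that(1) by (rule subspace_scale)
    then have "k \<le> lambda_max (K (p /\<^sub>R norm p))" using that by (intro k) auto
    then have "k * norm p \<le> lambda_max (K (p /\<^sub>R norm p)) * norm p" by (simp add: mult_right_mono)
    also have "\<dots> = lambda_max (norm p *\<^sub>R K (p /\<^sub>R norm p))"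
      using that herm by (simp add: lambda_max_scaleR)
    also have "norm p *\<^sub>R K (p /\<^sub>R norm p) = (G + K p) + (-1) *\<^sub>R G"
      using lin that by (simp add: linear_scale)
    also have "lambda_max \<dots> \<le> f p + c"
      unfolding f_def c_def using G herm
      by (intro lambda_max_subadditive hermitian_add hermitian_scaleR)
    finally show ?thesis by simp
  qed
  \<comment> \<open>Outside the ball of this radius the growth bound exceeds the value at \<open>0\<close>.\<close>
  define R where "R = max 0 ((f 0 + c) / k)"
  have "compact (S \<inter> cball 0 R)" using \<open>closed S\<close> by (simp add: closed_Int_compact)
  moreover have "0 \<in> S \<inter> cball 0 R" using \<open>0 \<in> S\<close> by (simp add: R_def)
  moreover have "continuous_on (S \<inter> cball 0 R) f"
    unfolding f_def by (rule continuous_on_lambda_max[OF G lin herm])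
  ultimately have "\<exists>p\<in>S \<inter> cball 0 R. \<forall>q\<in>S \<inter> cball 0 R. f p \<le> f q"
    by (intro continuous_attains_inf) auto
  then obtain p where p: "\<And>q. q \<in> S \<inter> cball 0 R \<Longrightarrow> f p \<le> f q"
    by blast
  have "f p \<le> f q" if "q \<in> S" for q
  proof (cases "norm q \<le> R")
    case False
    then have "(f 0 + c) / k < norm q" by (simp add: R_def)
    then have "f 0 + c < k * norm q" using k(1) by (simp add: pos_divide_less_eq mult.commute)
    moreover have "q \<noteq> 0" using False by (auto simp: R_def)
    ultimately have "f 0 < f q" using growth[OF that] by linarith
    then show ?thesis using p[of 0] \<open>0 \<in> S\<close> by (simp add: R_def)
  qed (use p that in simp)
  then have "f p \<le> f q" for q using reduce[of q] by auto
  then show ?thesis by (auto simp: f_def)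
qed

section \<open>Block matrices acting on stacked vectors\<close>

definition stack :: "complex^'r \<Rightarrow> complex^'s \<Rightarrow> complex^('r+'s)" where
  "stack a e = (\<chi> i. case i of Inl k \<Rightarrow> a $ k | Inr k \<Rightarrow> e $ k)"

lemma stack_nth [simp]: "stack a e $ Inl i = a $ i" "stack a e $ Inr k = e $ k"
  by (simp_all add: stack_def)

lemma vec_eq_stack: obtains a e where "w = stack a e"
proof
  show "w = stack (\<chi> i. w $ Inl i) (\<chi> k. w $ Inr k)"
    by (simp add: vec_eq_iff stack_def split: sum.split)
qed

lemma stack_cscale: "c *s stack a e = stack (c *s a) (c *s e)"
  by (simp add: vec_eq_iff stack_def split: sum.split)

lemma sum_UNIV_Plus: "(\<Sum>i\<in>UNIV. g i) = (\<Sum>i\<in>UNIV. g (Inl i)) + (\<Sum>k\<in>UNIV. g (Inr k))"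
  for g :: "'r::finite + 's::finite \<Rightarrow> 'b::comm_monoid_add"
  using sum.Plus[of UNIV UNIV g] by simp

lemma inner_stack: "stack a e \<bullet> stack b f = a \<bullet> b + e \<bullet> f"
  by (simp add: inner_vec_def sum_UNIV_Plus)

lemma block_row_mult_stack: "block_row A B *v stack a e = A *v a + B *v e"
  by (simp add: vec_eq_iff matrix_vector_mult_def block_row_def sum_UNIV_Plus)

lemma block_col_mult: "block_col A B *v x = stack (A *v x) (B *v x)"
  by (simp add: vec_eq_iff matrix_vector_mult_def block_col_def stack_def split: sum.split)

lemma block_mat_mult_stack:
  "block_mat A B C D *v stack a e = stack (A *v a + B *v e) (C *v a + D *v e)"
  by (simp add: block_mat_def block_col_mult block_row_mult_stack)

section \<open>The quadratic forms of the parameter matrices\<close>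

lemma inner_imaginary_swap:
  fixes M :: "complex^'n^'m"
  shows "b \<bullet> (\<i> *s (M *v y)) = - (y \<bullet> (\<i> *s (conj_transpose M *v b)))"
proof -
  have "b \<bullet> (\<i> *s (M *v y)) = (M *v (\<i> *s y)) \<bullet> b"
    by (simp add: inner_commute matrix_vector_mult_cscale)
  also have "\<dots> = y \<bullet> (cnj \<i> *s (conj_transpose M *v b))"
    by (simp only: inner_conj_transpose inner_cscale)
  finally show ?thesis by simp
qed

lemma G_mat_form:
  "stack a e \<bullet> (G_mat z M *v stack b f) = (M *v (a + z *s e)) \<bullet> (M *v (b + z *s f))"
proof -
  define g where "g = M *v (b + z *s f)"
  have "G_mat z M *v stack b f
      = stack (conj_transpose M *v g) (cnj z *s (conj_transpose M *v g))"
    by (simp add: G_mat_def g_def block_col_mult block_row_mult_stack smult_mat_mult_vec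
        flip: matrix_vector_mul_assoc)
  moreover have "e \<bullet> (cnj z *s (conj_transpose M *v g)) = (z *s e) \<bullet> (conj_transpose M *v g)"
    by (simp add: inner_cscale)
  ultimately show ?thesis
    by (simp add: inner_stack inner_conj_transpose inner_add_left flip: g_def)
qed

text \<open>The forms of \<open>H1\<close> and \<open>H2\<close> are given in polarized shape, since the visible symmetry in the two
  arguments then also proves that the matrices are Hermitian.\<close>

lemma H1_mat_form:
  "stack a e \<bullet> (H1_mat z M *v stack b f)
    = a \<bullet> (\<i> *s (M *v (b + z *s f))) + b \<bullet> (\<i> *s (M *v (a + z *s e)))"
proof -
  define h where "h = \<i> *s (conj_transpose M *v b)"
  have "H1_mat z M *v stack b f = stack (\<i> *s (M *v (b + z *s f)) - h) (- (cnj z *s h))"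
    by (simp add: H1_mat_def h_def smult_mat_mult_vec block_mat_mult_stack stack_cscale
        matrix_vector_mult_cscale vec_eq_iff matrix_vector_mult_diff_rdistrib
        matrix_vector_right_distrib uminus_mat_mult_vec algebra_simps)
  moreover have "e \<bullet> (cnj z *s h) = (z *s e) \<bullet> h"
    by (simp add: inner_cscale)
  ultimately show ?thesis
    by (simp add: inner_stack inner_imaginary_swap[of b] inner_diff_right inner_add_left flip: h_def)
qed

lemma H2_mat_form:
  "stack a e \<bullet> (H2_mat z M *v stack b f)
    = e \<bullet> (\<i> *s (M *v (b + z *s f))) + f \<bullet> (\<i> *s (M *v (a + z *s e)))"
proof -
  define h where "h = \<i> *s (conj_transpose M *v f)"
  have "H2_mat z M *v stack b f = stack (- h) (\<i> *s (M *v (b + z *s f)) - (cnj z *s h))"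
    by (simp add: H2_mat_def h_def smult_mat_mult_vec block_mat_mult_stack stack_cscale
        matrix_vector_mult_cscale vec_eq_iff matrix_vector_mult_diff_rdistrib
        matrix_vector_right_distrib uminus_mat_mult_vec algebra_simps)
  moreover have "e \<bullet> (cnj z *s h) = (z *s e) \<bullet> h"
    by (simp add: inner_cscale)
  ultimately show ?thesis
    by (simp add: inner_stack inner_imaginary_swap[of f] inner_diff_right inner_add_left flip: h_def)
qed

lemma hermitian_stackI:
  fixes H :: "complex^('r::finite+'s::finite)^('r+'s)"
  assumes "\<And>a e b f. stack a e \<bullet> (H *v stack b f) = stack b f \<bullet> (H *v stack a e)"
  shows "hermitian H"
  unfolding hermitian_iff_self_adjoint
proof (intro allI)
  fix u v :: "complex^('r+'s)"
  obtain a e b f where "u = stack a e" "v = stack b f" by (metis vec_eq_stack)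
  then show "(H *v u) \<bullet> v = u \<bullet> (H *v v)" using assms by (simp add: inner_commute)
qed

lemma hermitian_G_mat: "hermitian (G_mat z M)"
  by (rule hermitian_stackI) (simp add: G_mat_form inner_commute)

lemma hermitian_H1_mat: "hermitian (H1_mat z M)"
  by (rule hermitian_stackI) (simp add: H1_mat_form)

lemma hermitian_H2_mat: "hermitian (H2_mat z M)"
  by (rule hermitian_stackI) (simp add: H2_mat_form)

lemma H_combination_form:
  "stack a e \<bullet> ((t0 *\<^sub>R H1_mat z M + t1 *\<^sub>R H2_mat z M) *v stack a e)
    = 2 * ((t0 *\<^sub>R a + t1 *\<^sub>R e) \<bullet> (\<i> *s (M *v (a + z *s e))))"
  by (simp add: matrix_vector_mult_add_rdistrib scaleR_mat_mult_vec inner_add_right inner_add_left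
      H1_mat_form H2_mat_form)

lemma pencil_mult: "pencil A E z *v x = A *v x + z *s (E *v x)"
  by (simp add: pencil_def matrix_vector_mult_add_rdistrib smult_mat_mult_vec)

lemma hermitian_pencil_real:
  assumes "hermitian A" "hermitian E"
  shows "hermitian (pencil A E (of_real r))"
proof -
  have "pencil A E (of_real r) = A + r *\<^sub>R E"
    unfolding matrix_eq by (simp add: pencil_mult matrix_vector_mult_add_rdistrib
        scaleR_mat_mult_vec scaleR_eq_cscale)
  then show ?thesis using assms by (simp add: hermitian_add hermitian_scaleR)
qed

lemma matrix_inv_mult:
  fixes L :: "'a::semiring_1^'n^'n"
  assumes "invertible L"
  shows "matrix_inv L *v (L *v x) = x" "L *v (matrix_inv L *v x) = x"
proof -
  have "L ** matrix_inv L = mat 1 \<and> matrix_inv L ** L = mat 1"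
    using assms unfolding matrix_inv_def invertible_def by (rule someI_ex)
  then show "matrix_inv L *v (L *v x) = x" "L *v (matrix_inv L *v x) = x"
    by (simp_all add: matrix_vector_mul_assoc)
qed

text \<open>By \<open>H_combination_form\<close> the form at \<open>(a, e)\<close> is twice the inner product of \<open>u = t0 a + t1 e\<close> with
  \<open>\<i> M y\<close>, where \<open>y = a + z e\<close>. If \<open>t0 z \<noteq> t1\<close>, the vectors \<open>u\<close> and \<open>y\<close> can be prescribed independently, so
  the form takes positive values. If \<open>t0 z = t1\<close> with \<open>t0 \<noteq> 0\<close>, then \<open>z\<close> is real and \<open>u = t0 y\<close>, and the form
  is a multiple of the imaginary part of \<open>x\<^sup>* L(z) x\<close> for \<open>x = M y\<close>; it vanishes as \<open>L(z)\<close> is Hermitian.\<close>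

lemma H_combination_not_semidefinite:
  fixes A E :: "complex^'n^'n"
  assumes herm: "hermitian A" "hermitian E" and inv: "invertible (pencil A E z)"
    and M: "M = matrix_inv (pencil A E z)"
    and neg: "\<And>w. w \<bullet> ((t0 *\<^sub>R H1_mat z M + t1 *\<^sub>R H2_mat z M) *v w) \<le> 0"
  shows "t0 *\<^sub>R H1_mat z M + t1 *\<^sub>R H2_mat z M = 0"
proof (cases "of_real t0 * z = of_real t1")
  case False
  define c where "c = of_real t0 * z - of_real t1"
  define x where "x = (1 :: complex^'n)"
  define y where "y = pencil A E z *v x"
  \<comment> \<open>The solution of \<open>t0 a + t1 e = \<i> x\<close> and \<open>a + z e = y\<close>, a linear system with determinant \<open>c\<close>.\<close>
  define a where "a = (1/c) *s (z *s (\<i> *s x) - of_real t1 *s y)"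
  define e where "e = (1/c) *s (of_real t0 *s y - \<i> *s x)"
  have c: "c \<noteq> 0" using False by (simp add: c_def)
  have "t0 *\<^sub>R a + t1 *\<^sub>R e = (1/c) *s (c *s (\<i> *s x))"
    by (simp add: a_def e_def c_def scaleR_eq_cscale vec_eq_iff algebra_simps del: divide_minus_left)
  then have u: "t0 *\<^sub>R a + t1 *\<^sub>R e = \<i> *s x" using c by simp
  have "a + z *s e = (1/c) *s (c *s y)"
    by (simp add: a_def e_def c_def vec_eq_iff algebra_simps)
  then have "M *v (a + z *s e) = x" using c inv by (simp add: y_def M matrix_inv_mult)
  then have "2 * ((\<i> *s x) \<bullet> (\<i> *s x)) \<le> 0"
    using neg[of "stack a e"] by (simp add: H_combination_form u)
  then have "\<i> *s x = 0" by (smt (verit) inner_gt_zero_iff)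
  then show ?thesis by (simp add: x_def vec_eq_iff)
next
  case eq: True
  show ?thesis
  proof (cases "t0 = 0")
    case True
    then show ?thesis using eq by simp
  next
    case False
    define r where "r = t1 / t0"
    have r: "z = of_real r" "t1 = t0 * r" using eq False by (simp_all add: r_def field_simps)
    define H where "H = t0 *\<^sub>R H1_mat z M + t1 *\<^sub>R H2_mat z M"
    have "hermitian H"
      by (simp add: H_def hermitian_add hermitian_scaleR hermitian_H1_mat hermitian_H2_mat)
    have zero: "w \<bullet> (H *v w) = 0" for w
    proof -
      obtain a e where w: "w = stack a e" by (rule vec_eq_stack)
      define x where "x = M *v (a + z *s e)"
      have x: "a + z *s e = pencil A E z *v x" using inv by (simp add: x_def M matrix_inv_mult)
      have "t0 *\<^sub>R a + t1 *\<^sub>R e = t0 *\<^sub>R (a + z *s e)"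
        using r by (simp add: scaleR_add_right flip: scaleR_eq_cscale)
      then have "w \<bullet> (H *v w) = 2 * (t0 * ((pencil A E z *v x) \<bullet> (\<i> *s x)))"
        by (simp only: w H_def H_combination_form flip: x_def) (simp add: x)
      also have "(pencil A E z *v x) \<bullet> (\<i> *s x) = 0"
        using hermitian_pencil_real[OF herm] r(1) by (simp add: hermitian_inner_imaginary)
      finally show ?thesis by simp
    qed
    have "H *v w = 0" for w
      using psd_isotropic_in_kernel[OF \<open>hermitian H\<close>] zero by simp
    then show ?thesis unfolding matrix_eq by (simp flip: H_def)
  qed
qed

section \<open>The distance to singularity\<close>

theorem lambda_max_param_attains_min:
  fixes A E :: "complex^'n^'n"
  assumes "hermitian A" "hermitian E" "invertible (pencil A E z)"
  shows "\<exists>t0 t1. \<forall>s0 s1. lambda_max_param A E z t0 t1 \<le> lambda_max_param A E z s0 s1"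
proof -
  define M where "M = matrix_inv (pencil A E z)"
  define K where "K p = fst p *\<^sub>R H1_mat z M + snd p *\<^sub>R H2_mat z M" for p :: "real \<times> real"
  have "\<exists>p. \<forall>q. lambda_max (G_mat z M + K p) \<le> lambda_max (G_mat z M + K q)"
  proof (rule lambda_max_affine_attains_min)
    show "linear K" by (rule linearI) (simp_all add: K_def algebra_simps)
    show "hermitian (K p)" for p
      by (simp add: K_def hermitian_add hermitian_scaleR hermitian_H1_mat hermitian_H2_mat)
    show "K p = 0" if "\<And>w. w \<bullet> (K p *v w) \<le> 0" for p
      using H_combination_not_semidefinite[OF assms M_def] that unfolding K_def by blast
  qed (rule hermitian_G_mat)
  then show ?thesis
    by (simp add: lambda_max_param_def K_def split_paired_All split_paired_Ex add.assoc flip: M_def)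
qed

lemma norm_mult_vec_le_spectral_norm: "norm (D *v x) \<le> spectral_norm D * norm x"
  for D :: "complex^'n^'m"
  unfolding spectral_norm_def
  by (rule onorm[OF linear_conv_bounded_linear[THEN iffD1, OF matrix_vector_mul_linear]])

lemma det_zero_kernel:
  fixes P :: "'a::field^'n^'n"
  assumes "det P = 0"
  obtains x where "x \<noteq> 0" "P *v x = 0"
  using assms invertible_det_nz[of P] matrix_left_invertible_ker[of P]
  by (auto simp: invertible_left_inverse)

text \<open>The Rayleigh quotient of \<open>G + t0 H1 + t1 H2\<close> is evaluated at the vector that stacks \<open>DA x\<close> on \<open>DE x\<close>,
  for a kernel vector \<open>x\<close> of the perturbed pencil at \<open>z\<close>.\<close>

theorem singular_perturbation_bound:
  fixes A E :: "complex^'n^'n"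
  assumes "hermitian DA" "hermitian DE" "invertible (pencil A E z)"
    and sing: "det (pencil (A - DA) (E - DE) z) = 0"
  shows "1 \<le> lambda_max_param A E z t0 t1 * ((spectral_norm DA)\<^sup>2 + (spectral_norm DE)\<^sup>2)"
proof -
  define M where "M = matrix_inv (pencil A E z)"
  define H where "H = G_mat z M + t0 *\<^sub>R H1_mat z M + t1 *\<^sub>R H2_mat z M"
  define D where "D = (spectral_norm DA)\<^sup>2 + (spectral_norm DE)\<^sup>2"
  have "hermitian H"
    by (simp add: H_def hermitian_add hermitian_scaleR hermitian_G_mat hermitian_H1_mat hermitian_H2_mat)
  obtain x where x: "x \<noteq> 0" "pencil (A - DA) (E - DE) z *v x = 0"
    using sing by (rule det_zero_kernel)
  define a where "a = DA *v x"
  define e where "e = DE *v x"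
  have "pencil A E z *v x = a + z *s e"
    using x(2) by (simp add: pencil_mult a_def e_def matrix_vector_mult_diff_rdistrib
        vector_ssub_ldistrib algebra_simps)
  then have Mx: "M *v (a + z *s e) = x"
    using assms(3) by (metis M_def matrix_inv_mult(1))
  have pos: "x \<bullet> x > 0" using x(1) by simp
  have "H = G_mat z M + (t0 *\<^sub>R H1_mat z M + t1 *\<^sub>R H2_mat z M)"
    by (simp add: H_def)
  then have "stack a e \<bullet> (H *v stack a e)
      = x \<bullet> x + 2 * ((t0 *\<^sub>R a + t1 *\<^sub>R e) \<bullet> (\<i> *s x))"
    by (simp add: matrix_vector_mult_add_rdistrib[of "G_mat z M"] inner_add_right[of _ "G_mat z M *v _"]
        G_mat_form H_combination_form Mx)
  also have "\<dots> = x \<bullet> x"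
    using assms(1,2) by (simp add: inner_add_left a_def e_def hermitian_inner_imaginary)
  finally have 1: "x \<bullet> x \<le> lambda_max H * (a \<bullet> a + e \<bullet> e)"
    using rayleigh_le_lambda_max[OF \<open>hermitian H\<close>, of "stack a e"] by (simp add: inner_stack)
  then have "0 < lambda_max H * (a \<bullet> a + e \<bullet> e)" using pos by linarith
  then have "lambda_max H \<ge> 0"
    by (smt (verit) inner_ge_zero mult_nonpos_nonneg)
  have "a \<bullet> a + e \<bullet> e \<le> (spectral_norm DA * norm x)\<^sup>2 + (spectral_norm DE * norm x)\<^sup>2"
    unfolding a_def e_def dot_square_norm
    by (intro add_mono power_mono norm_mult_vec_le_spectral_norm) auto
  also have "\<dots> = D * (x \<bullet> x)"
    by (simp add: D_def dot_square_norm power_mult_distrib algebra_simps)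
  finally have "lambda_max H * (a \<bullet> a + e \<bullet> e) \<le> lambda_max H * (D * (x \<bullet> x))"
    using \<open>lambda_max H \<ge> 0\<close> by (rule mult_left_mono)
  then have "1 * (x \<bullet> x) \<le> (lambda_max H * D) * (x \<bullet> x)" using 1 by simp
  then have "1 \<le> lambda_max H * D" using pos by (simp only: mult_le_cancel_right_pos)
  then show ?thesis by (simp add: lambda_max_param_def D_def H_def flip: M_def)
qed

lemma min2_eq:
  assumes "\<And>s0 s1. f t0 t1 \<le> f s0 s1"
  shows "min2 f = f t0 t1"
  unfolding min2_def by (rule Least_equality) (use assms in auto)

text \<open>The trivial singular perturbation makes the infimum in \<open>herm_dist\<close> one over a nonempty set, and
  it shows that \<open>\<lambda>\<^sub>m\<^sub>a\<^sub>x\<close> is positive.\<close>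

lemma det_pencil_diff_self: "det (pencil (A - A) (E - E) z) = 0"
  by (rule det_zero_row(1)) (simp add: pencil_def smult_mat_def row_def vec_eq_iff)

lemma herm_dist_bound:
  fixes A E :: "complex^'n^'n"
  assumes herm: "hermitian A" "hermitian E"
    and bound: "\<And>DA DE. hermitian DA \<Longrightarrow> hermitian DE \<Longrightarrow>
      (\<And>z. det (pencil (A - DA) (E - DE) z) = 0) \<Longrightarrow>
      b \<le> (spectral_norm DA)\<^sup>2 + (spectral_norm DE)\<^sup>2"
  shows "b \<le> (herm_dist A E)\<^sup>2"
proof (cases "b \<ge> 0")
  case True
  have "sqrt b \<le> herm_dist A E"
    unfolding herm_dist_def
  proof (rule cInf_greatest)
    show "{sqrt ((spectral_norm DA)\<^sup>2 + (spectral_norm DE)\<^sup>2) | DA DE.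
        hermitian DA \<and> hermitian DE \<and> (\<forall>z. det (pencil (A - DA) (E - DE) z) = 0)} \<noteq> {}"
      using herm det_pencil_diff_self[of A E] by blast
  qed (use bound in \<open>auto\<close>)
  then have "(sqrt b)\<^sup>2 \<le> (herm_dist A E)\<^sup>2" using True by (intro power_mono) auto
  then show ?thesis using True by simp
qed (smt (verit) zero_le_power2)

theorem theorem5p3:
  fixes A E :: "complex^'n^'n" and l :: "nat \<Rightarrow> complex"
  assumes "hermitian A" and "hermitian E"
    and "regular_pencil A E"
    and "l \<in> admissible_points A E - ({1..CARD('n) + 1} \<rightarrow> \<real>)"
  shows "(\<forall>j \<in> {1..CARD('n) + 1}.
            (\<exists>t0 t1. \<forall>s0 s1. lambda_max_param A E (l j) t0 t1 \<le> lambda_max_param A E (l j) s0 s1) \<and>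
            min2 (lambda_max_param A E (l j)) \<noteq> 0) \<and>
         (herm_dist A E)\<^sup>2 \<ge>
           (MAX j \<in> {1..CARD('n) + 1}. inverse (min2 (lambda_max_param A E (l j))))"
proof -
  have point: "(\<exists>t0 t1. \<forall>s0 s1. lambda_max_param A E (l j) t0 t1 \<le> lambda_max_param A E (l j) s0 s1) \<and>
      min2 (lambda_max_param A E (l j)) \<noteq> 0 \<and>
      inverse (min2 (lambda_max_param A E (l j))) \<le> (herm_dist A E)\<^sup>2"
    if "j \<in> {1..CARD('n) + 1}" for j
  proof -
    have inv: "invertible (pencil A E (l j))"
      using assms(4) that by (simp add: admissible_points_def)
    obtain t0 t1 where t: "\<And>s0 s1. lambda_max_param A E (l j) t0 t1 \<le> lambda_max_param A E (l j) s0 s1"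
      using lambda_max_param_attains_min[OF assms(1,2) inv] by blast
    define m where "m = min2 (lambda_max_param A E (l j))"
    have m: "m = lambda_max_param A E (l j) t0 t1"
      unfolding m_def by (rule min2_eq) (rule t)
    have le: "1 \<le> m * ((spectral_norm DA)\<^sup>2 + (spectral_norm DE)\<^sup>2)"
      if "hermitian DA" "hermitian DE" "\<And>z. det (pencil (A - DA) (E - DE) z) = 0" for DA DE
      unfolding m by (rule singular_perturbation_bound[OF that(1,2) inv that(3)])
    have "1 \<le> m * ((spectral_norm A)\<^sup>2 + (spectral_norm E)\<^sup>2)"
      by (rule le[OF assms(1,2) det_pencil_diff_self])
    then have "0 < m * ((spectral_norm A)\<^sup>2 + (spectral_norm E)\<^sup>2)" by linarith
    then have "m > 0" by (smt (verit) mult_nonpos_nonneg zero_le_power2)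
    then have "inverse m \<le> (herm_dist A E)\<^sup>2"
      using le by (intro herm_dist_bound assms) (auto simp: field_simps)
    with t \<open>m > 0\<close> show ?thesis unfolding m_def by fastforce
  qed
  then show ?thesis by (simp add: Max_le_iff)
qed

end
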